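(* Fix an integer $d\ge 3$, a real $\delta\in(-\infty,d-1)$ and a constant $c\in(0,\infty)$, and let $p=p_n=(c+o_n(1))\,n^{-d+1+\delta}$. Let $\mathcal{H}$ be the random $d$-uniform hypergraph on $[n]$ in which each $d$-subset of $[n]$ is a hyperedge independently with probability $p$. If $\delta<\frac{d-1}{d+1}$ then the partial recovery loss is $o_n(1)$, and if $\delta>\frac{d-1}{d+1}$ then the partial recovery loss is $1-o_n(1)$.
   Context: For a $d$-uniform hypergraph $H$ on vertex set $[n]$, its projection $\mathrm{Proj}(H)$ is the graph on $[n]$ in which $\{i,j\}$ ($i\neq j$) is an edge iff some hyperedge of $H$ contains $\{i,j\}$. Let $\mathcal{G}$ denote the set of graphs on $[n]$ arising as projections of $d$-uniform hypergraphs. For a (deterministic) function $\mathcal{B}:\mathcal{G}\to\{0,1\}^{\binom{[n]}{d}}$ (a set of $d$-subsets), its loss is $\ell(\mathcal{B})=\mathbb{E}[|\mathcal{B}(\mathrm{Proj}(\mathcal{H}))\,\Delta\, E(\mathcal{H})|]/(p\binom{n}{d})$, where $\Delta$ is symmetric difference. The partial recovery loss is the minimum of $\ell(\mathcal{B})$ over all such $\mathcal{B}$ (attained by $\mathcal{B}^*(G)=\{h:\Pr[h\in E(\mathcal{H})\mid \mathrm{Proj}(\mathcal{H})=G]\ge 1/2\}$). Asymptotics are as $n\to\infty$ with $d,\delta,c$ fixed. *)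

theory Defs
  imports "HOL-Probability.Probability"
begin

text \<open>
  The vertex set is \<open>{1..n}\<close>.  A \<open>d\<close>-uniform hypergraph on it is identified with its set of
  hyperedges, a subset of \<open>d_subsets n d\<close>, and a graph with its set of edges.
\<close>

definition d_subsets :: "nat \<Rightarrow> nat \<Rightarrow> nat set set" where
  "d_subsets n d = {h. h \<subseteq> {1..n} \<and> card h = d}"

definition Proj :: "nat set set \<Rightarrow> nat set set" where
  "Proj H = {{i, j} | i j. i \<noteq> j \<and> (\<exists>h\<in>H. {i, j} \<subseteq> h)}"

definition projected_graphs :: "nat \<Rightarrow> nat \<Rightarrow> nat set set set" where
  "projected_graphs n d = Proj ` Pow (d_subsets n d)"

text \<open>
  \<open>bernoulli_pmf\<close> truncates its parameter to \<open>[0, 1]\<close>, so this is the intended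
  distribution exactly when \<open>0 \<le> p \<le> 1\<close>.
\<close>

definition random_hypergraph :: "nat \<Rightarrow> nat \<Rightarrow> real \<Rightarrow> nat set set pmf" where
  "random_hypergraph n d p =
     map_pmf (\<lambda>f. {h \<in> d_subsets n d. f h})
       (Pi_pmf (d_subsets n d) False (\<lambda>_. bernoulli_pmf p))"

definition estimators :: "nat \<Rightarrow> nat \<Rightarrow> (nat set set \<Rightarrow> nat set set) set" where
  "estimators n d = projected_graphs n d \<rightarrow>\<^sub>E Pow (d_subsets n d)"

definition loss :: "nat \<Rightarrow> nat \<Rightarrow> real \<Rightarrow> (nat set set \<Rightarrow> nat set set) \<Rightarrow> real" where
  "loss n d p B =
     measure_pmf.expectation (random_hypergraph n d p)
       (\<lambda>H. real (card (sym_diff (B (Proj H)) H)))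
     / (p * real (n choose d))"

definition partial_recovery_loss :: "nat \<Rightarrow> nat \<Rightarrow> real \<Rightarrow> real" where
  "partial_recovery_loss n d p = Min (loss n d p ` estimators n d)"

text \<open>The minimum is over a finite nonempty set, so \<open>Min\<close> is meaningful.\<close>

lemma finite_d_subsets: "finite (d_subsets n d)"
  unfolding d_subsets_def by (rule finite_subset[of _ "Pow {1..n}"]) auto

lemma finite_estimators: "finite (estimators n d)"
  unfolding estimators_def projected_graphs_def
  by (intro finite_PiE finite_imageI) (simp_all add: finite_d_subsets)

lemma estimators_nonempty: "estimators n d \<noteq> {}"
  unfolding estimators_def by (auto simp: PiE_eq_empty_iff)

end

theory Submission
  imports Defs
begin

text \<open>
  Write \<open>D = d choose 2\<close>.  A non-hyperedge \<open>h\<close> is a clique of the projection only if the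
  traces on \<open>h\<close> of some hyperedges cover all pairs of \<open>h\<close>; a trace of size \<open>s\<close> costs a
  factor \<open>n powr (1 + \<delta> - s)\<close>.  For \<open>\<delta> < (d - 1) / (d + 1)\<close> every such cover is less
  likely than \<open>h\<close> itself, so the estimator returning all \<open>d\<close>-cliques has loss tending to \<open>0\<close>.

  For \<open>\<delta> > (d - 1) / (d + 1)\<close> the cheapest cover consists of the \<open>D\<close> pairs (when \<open>\<delta> \<ge> 1\<close>
  every \<open>d\<close>-set may be counted as a clique, since the projection costs only \<open>O(1)\<close> per
  hyperedge), and false cliques outnumber the hyperedges by a power of \<open>n\<close>.  An estimator that gets a fraction \<open>\<gamma>\<close>
  of the hyperedges right would give a code for the hypergraph: describe the projection, which
  has at most \<open>D\<close> edges per hyperedge, then the hyperedges among its cliques, at one bit for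
  each \<open>d\<close>-set returned by the estimator.  To leading order, describing the projection and then
  choosing hyperedges among its cliques already costs exactly the entropy of the hypergraph, so
  the \<open>\<gamma> ln n\<close> per hyperedge saved by the estimator contradicts Gibbs' inequality unless \<open>\<gamma>\<close>
  is \<open>O(1 / ln n)\<close> or the estimator returns more wrong than right sets.
\<close>

subsection \<open>Averages over random subsets\<close>

text \<open>A finite sum rather than an integral: linearity needs no integrability, and
  \<open>prod_add\<close> evaluates product weights. For \<open>0 \<le> p \<le> 1\<close>,
  \<open>expectation_random_hypergraph\<close> links it to the model.\<close>

definition subset_mean :: "'a set \<Rightarrow> real \<Rightarrow> ('a set \<Rightarrow> real) \<Rightarrow> real" where
  "subset_mean E p f = (\<Sum>H\<in>Pow E. p ^ card H * (1 - p) ^ card (E - H) * f H)"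

lemma subset_mean_mono:
  assumes "0 \<le> p" "p \<le> 1" "\<And>H. H \<subseteq> E \<Longrightarrow> f H \<le> g H"
  shows "subset_mean E p f \<le> subset_mean E p g"
  unfolding subset_mean_def using assms by (intro sum_mono mult_left_mono) auto

lemma subset_mean_cong:
  assumes "\<And>H. H \<subseteq> E \<Longrightarrow> f H = g H"
  shows "subset_mean E p f = subset_mean E p g"
  unfolding subset_mean_def using assms by (intro sum.cong) auto

lemma subset_mean_add:
  "subset_mean E p (\<lambda>H. f H + g H) = subset_mean E p f + subset_mean E p g"
  unfolding subset_mean_def by (simp add: sum.distrib distrib_left)

lemma subset_mean_diff:
  "subset_mean E p (\<lambda>H. f H - g H) = subset_mean E p f - subset_mean E p g"
  unfolding subset_mean_def by (simp add: sum_subtractf right_diff_distrib)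

lemma subset_mean_cmult: "subset_mean E p (\<lambda>H. a * f H) = a * subset_mean E p f"
  unfolding subset_mean_def by (simp add: sum_distrib_left mult_ac)

lemma subset_mean_sum:
  "subset_mean E p (\<lambda>H. \<Sum>i\<in>I. f i H) = (\<Sum>i\<in>I. subset_mean E p (f i))"
  unfolding subset_mean_def by (simp add: sum_distrib_left sum.swap[of _ I])

text \<open>Expand a product over \<open>E\<close> with one factor \<open>p + (1 - p)\<close> per
  element, but \<open>p + 0\<close> for elements of \<open>T\<close>: the zero kills exactly the
  \<open>H\<close> that miss a member of \<open>T\<close>.\<close>

lemma subset_mean_superset:
  assumes "finite E" "T \<subseteq> E"
  shows "subset_mean E p (\<lambda>H. of_bool (T \<subseteq> H)) = p ^ card T"
proof -
  have "subset_mean E p (\<lambda>H. of_bool (T \<subseteq> H)) =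
    (\<Sum>H\<in>Pow E. (\<Prod>h\<in>H. p) * (\<Prod>h\<in>E - H. if h \<in> T then 0 else 1 - p))"
    unfolding subset_mean_def
  proof (intro sum.cong refl)
    fix H assume H: "H \<in> Pow E"
    show "p ^ card H * (1 - p) ^ card (E - H) * of_bool (T \<subseteq> H)
      = (\<Prod>h\<in>H. p) * (\<Prod>h\<in>E - H. if h \<in> T then 0 else 1 - p)"
    proof (cases "T \<subseteq> H")
      case True
      have "(\<Prod>h\<in>E - H. if h \<in> T then 0 else 1 - p) = (\<Prod>h\<in>E - H. 1 - p)"
        using True by (intro prod.cong) auto
      then show ?thesis using True by simp
    next
      case False
      then obtain t where "t \<in> T" "t \<notin> H" by auto
      then have "(\<Prod>h\<in>E - H. if h \<in> T then 0 else 1 - p) = 0"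
        using assms by (intro prod_zero) auto
      then show ?thesis using False by simp
    qed
  qed
  also have "\<dots> = (\<Prod>h\<in>E. p + (if h \<in> T then 0 else 1 - p))"
    using assms by (subst prod_add) auto
  also have "\<dots> = (\<Prod>h\<in>E. if h \<in> T then p else 1)"
    by (intro prod.cong) auto
  also have "\<dots> = p ^ card T"
    using assms by (simp add: prod.If_cases Int_absorb1)
  finally show ?thesis .
qed

lemma subset_mean_const: "finite E \<Longrightarrow> subset_mean E p (\<lambda>_. a) = a"
  using subset_mean_superset[of E "{}" p] subset_mean_cmult[of E p a "\<lambda>_. 1"] by simp

lemma subset_mean_card:
  assumes "finite E"
  shows "subset_mean E p (\<lambda>H. real (card H)) = p * real (card E)"
proof -
  have "subset_mean E p (\<lambda>H. real (card H)) = subset_mean E p (\<lambda>H. \<Sum>h\<in>E. of_bool ({h} \<subseteq> H))"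
  proof (intro subset_mean_cong)
    fix H assume "H \<subseteq> E"
    then show "real (card H) = (\<Sum>h\<in>E. of_bool ({h} \<subseteq> H))"
      using assms by (simp add: of_bool_def sum.If_cases Int_absorb1)
  qed
  also have "\<dots> = (\<Sum>h\<in>E. p ^ card {h})"
    unfolding subset_mean_sum using assms by (intro sum.cong refl subset_mean_superset) auto
  finally show ?thesis by simp
qed

text \<open>Nonnegativity of relative entropy, from \<open>ln x \<le> x - 1\<close>. Total mass at
  most 1 suffices for \<open>R\<close>, so a code may waste mass on impossible outcomes.\<close>

lemma subset_mean_gibbs:
  assumes E: "finite E" and p: "0 < p" "p < 1"
    and R: "\<And>H. H \<subseteq> E \<Longrightarrow> R H > 0" "(\<Sum>H\<in>Pow E. R H) \<le> 1"
  shows "subset_mean E p (\<lambda>H. ln (R H / (p ^ card H * (1 - p) ^ card (E - H)))) \<le> 0"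
proof -
  define w where "w H = p ^ card H * (1 - p) ^ card (E - H)" for H
  have w: "w H > 0" for H using p by (auto simp: w_def)
  have "subset_mean E p (\<lambda>H. ln (R H / w H)) \<le> subset_mean E p (\<lambda>H. R H / w H - 1)"
    using p R w by (intro subset_mean_mono ln_le_minus_one) auto
  also have "\<dots> = (\<Sum>H\<in>Pow E. R H) - 1"
  proof -
    have "w H * (R H / w H) = R H" for H using w[of H] by simp
    then have "subset_mean E p (\<lambda>H. R H / w H) = (\<Sum>H\<in>Pow E. R H)"
      unfolding subset_mean_def w_def[symmetric] by simp
    then show ?thesis by (simp add: subset_mean_diff subset_mean_const E)
  qed
  finally show ?thesis using R(2) by (simp add: w_def)
qed

lemma expectation_random_hypergraph:
  assumes p: "0 \<le> p" "p \<le> 1"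
  shows "measure_pmf.expectation (random_hypergraph n d p) f = subset_mean (d_subsets n d) p f"
proof -
  define E where "E = d_subsets n d"
  define D where "D = Pi_pmf E False (\<lambda>_. bernoulli_pmf p)"
  define s where "s f = {h \<in> E. f h}" for f :: "nat set \<Rightarrow> bool"
  have fin: "finite E" by (simp add: E_def finite_d_subsets)
  have rh: "random_hypergraph n d p = map_pmf s D"
    by (simp add: random_hypergraph_def E_def D_def s_def[abs_def])
  have pmf: "pmf (map_pmf s D) H = p ^ card H * (1 - p) ^ card (E - H)" if H: "H \<subseteq> E" for H
  proof -
    have "pmf (map_pmf s D) H = measure (measure_pmf D) {\<lambda>h. h \<in> H}"
      unfolding pmf_map
    proof (rule measure_eq_AE)
      \<comment> \<open>Off \<open>E\<close> the product measure takes the default value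
        \<open>False\<close>, so on its support only the indicator function of \<open>H\<close> is
        mapped to \<open>H\<close>.\<close>
      show "AE x in measure_pmf D. (x \<in> s -` {H}) = (x \<in> {\<lambda>h. h \<in> H})"
      proof (rule AE_pmfI)
        fix g assume "g \<in> set_pmf D"
        then have "g h = False" if "h \<notin> E" for h
          using that set_Pi_pmf_subset[OF fin, of False "\<lambda>_. bernoulli_pmf p"]
          unfolding D_def by auto
        then show "(g \<in> s -` {H}) = (g \<in> {\<lambda>h. h \<in> H})"
          using H unfolding s_def by (auto simp: fun_eq_iff)
      qed
    qed auto
    also have "\<dots> = pmf D (\<lambda>h. h \<in> H)" by (simp add: pmf.rep_eq)
    also have "\<dots> = (\<Prod>h\<in>E. pmf (bernoulli_pmf p) (h \<in> H))"
      unfolding D_def using H fin by (intro pmf_Pi') auto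
    also have "\<dots> = (\<Prod>h\<in>E. if h \<in> H then p else 1 - p)"
      using p by (intro prod.cong) auto
    also have "\<dots> = p ^ card H * (1 - p) ^ card (E - H)"
      using H fin by (simp add: prod.If_cases Int_absorb1 Diff_eq)
    finally show ?thesis .
  qed
  have "measure_pmf.expectation (map_pmf s D) f = (\<Sum>H\<in>Pow E. pmf (map_pmf s D) H * f H)"
    using fin by (subst integral_measure_pmf[of "Pow E"]) (auto simp: s_def)
  also have "\<dots> = subset_mean E p f"
    unfolding subset_mean_def by (intro sum.cong) (auto simp: pmf)
  finally show ?thesis by (simp add: rh E_def)
qed

subsection \<open>Cliques of the projection and pair covers\<close>

definition cliques :: "nat \<Rightarrow> nat \<Rightarrow> nat set set \<Rightarrow> nat set set" where
  "cliques n d G = {h \<in> d_subsets n d. \<forall>i\<in>h. \<forall>j\<in>h. i \<noteq> j \<longrightarrow> {i, j} \<in> G}"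

lemma d_subsetsD: "h \<in> d_subsets n d \<Longrightarrow> finite h \<and> h \<subseteq> {1..n} \<and> card h = d"
  unfolding d_subsets_def using finite_subset[of h "{1..n}"] by auto

lemma card_d_subsets: "card (d_subsets n d) = n choose d"
  unfolding d_subsets_def using n_subsets[of "{1..n}" d] by simp

lemma cliques_subset: "cliques n d G \<subseteq> d_subsets n d"
  by (auto simp: cliques_def)

lemma subset_cliques_Proj: "H \<subseteq> d_subsets n d \<Longrightarrow> H \<subseteq> cliques n d (Proj H)"
  unfolding cliques_def Proj_def by blast

lemma Proj_eq: "Proj H = (\<Union>h\<in>H. {e. e \<subseteq> h \<and> card e = 2})"
proof -
  have "e \<in> Proj H \<longleftrightarrow> (\<exists>h\<in>H. e \<subseteq> h \<and> card e = 2)" for e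
    unfolding Proj_def card_2_iff by blast
  then show ?thesis by blast
qed

lemma Proj_subset: "H \<subseteq> d_subsets n d \<Longrightarrow> Proj H \<subseteq> d_subsets n 2"
  unfolding Proj_eq d_subsets_def by blast

lemma card_Proj_le:
  assumes "H \<subseteq> d_subsets n d"
  shows "card (Proj H) \<le> (d choose 2) * card H"
proof -
  have fin: "finite H" using assms finite_d_subsets finite_subset by blast
  have "card (Proj H) \<le> (\<Sum>h\<in>H. card {e. e \<subseteq> h \<and> card e = 2})"
    unfolding Proj_eq by (rule card_UN_le[OF fin])
  also have "\<dots> = (\<Sum>h\<in>H. d choose 2)"
    using assms by (intro sum.cong refl, subst n_subsets) (auto dest!: d_subsetsD)
  finally show ?thesis by (simp add: mult.commute)
qed

section \<open>Covering the pairs of a vertex set by traces of hyperedges\<close>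

definition pair_covers :: "'a set \<Rightarrow> 'a set set set" where
  "pair_covers h = {F. F \<subseteq> {S. S \<subseteq> h \<and> 2 \<le> card S} \<and> {e. e \<subseteq> h \<and> card e = 2} \<subseteq> (\<Union>S\<in>F. Pow S)}"

text \<open>The ways of choosing one hyperedge for each trace in \<open>F\<close>. Extensionality
  makes these choices countable by \<open>card_PiE\<close>.\<close>

definition traces :: "nat \<Rightarrow> nat \<Rightarrow> nat set \<Rightarrow> nat set set \<Rightarrow> (nat set \<Rightarrow> nat set) set" where
  "traces n d h F = (\<Pi>\<^sub>E S\<in>F. {h' \<in> d_subsets n d. h' \<inter> h = S})"

lemma finite_pair_covers: "finite h \<Longrightarrow> finite (pair_covers h)"
  by (rule finite_subset[of _ "Pow (Pow h)"]) (auto simp: pair_covers_def)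

lemma card_pair_covers_le:
  assumes "finite h"
  shows "card (pair_covers h) \<le> 2 ^ 2 ^ card h"
proof -
  have "card (pair_covers h) \<le> card (Pow (Pow h))"
    using assms by (intro card_mono) (auto simp: pair_covers_def)
  then show ?thesis using assms by (simp add: card_Pow)
qed

lemma pair_covers_choose_le:
  assumes "finite h" "F \<in> pair_covers h"
  shows "card h choose 2 \<le> (\<Sum>S\<in>F. card S choose 2)"
proof -
  have F: "finite F" "\<And>S. S \<in> F \<Longrightarrow> finite S"
    using assms finite_subset[of F "Pow h"] finite_subset[of _ h] by (auto simp: pair_covers_def)
  have "card h choose 2 = card {e. e \<subseteq> h \<and> card e = 2}"
    using assms by (simp add: n_subsets)
  also have "\<dots> \<le> card (\<Union>S\<in>F. {e. e \<subseteq> S \<and> card e = 2})"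
    using assms F by (intro card_mono finite_UN_I) (auto simp: pair_covers_def)
  also have "\<dots> \<le> (\<Sum>S\<in>F. card {e. e \<subseteq> S \<and> card e = 2})"
    by (rule card_UN_le[OF F(1)])
  also have "\<dots> = (\<Sum>S\<in>F. card S choose 2)"
    using F by (intro sum.cong refl n_subsets) auto
  finally show ?thesis .
qed

text \<open>Take all traces of size at least 2: every pair of \<open>h\<close> is an edge, hence
  lies in one of them. A hyperedge with trace \<open>h\<close> contains \<open>h\<close> and has the
  same size, so it is \<open>h\<close>; the last clause therefore lets false cliques be charged to
  covers that avoid \<open>h\<close>.\<close>

lemma clique_Proj_traces:
  assumes H: "H \<subseteq> d_subsets n d" and h: "h \<in> cliques n d (Proj H)"
  obtains F \<phi> where "F \<in> pair_covers h" "\<phi> \<in> traces n d h F" "\<phi> ` F \<subseteq> H" "h \<in> F \<longrightarrow> h \<in> H"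
proof -
  define F where "F = {S. 2 \<le> card S \<and> (\<exists>h'\<in>H. h' \<inter> h = S)}"
  have "\<forall>S\<in>F. \<exists>h'. h' \<in> H \<and> h' \<inter> h = S" by (auto simp: F_def)
  then obtain \<phi> where \<phi>: "\<And>S. S \<in> F \<Longrightarrow> \<phi> S \<in> H \<and> \<phi> S \<inter> h = S" by metis
  have "\<exists>S\<in>F. e \<subseteq> S" if e: "e \<subseteq> h" "card e = 2" for e
  proof -
    obtain i j where ij: "e = {i, j}" "i \<noteq> j" using e card_2_iff by metis
    then have "e \<in> Proj H" using h e unfolding cliques_def by auto
    then obtain h' where h': "h' \<in> H" "e \<subseteq> h'" unfolding Proj_eq by auto
    have "card e \<le> card (h' \<inter> h)"
      using h' e H by (intro card_mono) (auto dest!: d_subsetsD)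
    then show ?thesis using h' e by (intro bexI[of _ "h' \<inter> h"]) (auto simp: F_def)
  qed
  then have "F \<in> pair_covers h"
    unfolding pair_covers_def by (auto simp: F_def)
  moreover have "restrict \<phi> F \<in> traces n d h F"
    using \<phi> H unfolding traces_def by auto
  moreover have "restrict \<phi> F ` F \<subseteq> H" using \<phi> by auto
  moreover have "h \<in> F \<longrightarrow> h \<in> H"
  proof
    assume "h \<in> F"
    then have *: "\<phi> h \<in> H" "h \<subseteq> \<phi> h" using \<phi> by auto
    have "h \<in> d_subsets n d" "\<phi> h \<in> d_subsets n d" using h * H cliques_subset by blast+
    then have "h = \<phi> h" using * by (intro card_subset_eq) (auto dest!: d_subsetsD)
    then show "h \<in> H" using * by simp
  qed
  ultimately show thesis using that by blast
qed

text \<open>Once its trace is fixed, a hyperedge is determined by its \<open>d - card S\<close>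
  vertices outside \<open>h\<close>.\<close>

lemma card_trace_le:
  assumes "finite h" "S \<subseteq> h"
  shows "card {h' \<in> d_subsets n d. h' \<inter> h = S} \<le> n ^ (d - card S)"
proof -
  have S: "finite S" using assms finite_subset by blast
  have "inj_on (\<lambda>h'. h' - h) {h' \<in> d_subsets n d. h' \<inter> h = S}"
  proof (rule inj_onI)
    fix x y assume *: "x \<in> {h' \<in> d_subsets n d. h' \<inter> h = S}" "y \<in> {h' \<in> d_subsets n d. h' \<inter> h = S}" "x - h = y - h"
    have "x = (x - h) \<union> (x \<inter> h)" "y = (y - h) \<union> (y \<inter> h)" by auto
    with * show "x = y" by simp
  qed
  moreover have "(\<lambda>h'. h' - h) ` {h' \<in> d_subsets n d. h' \<inter> h = S} \<subseteq> d_subsets n (d - card S)"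
    using S by (auto simp: d_subsets_def card_Diff_subset_Int)
  ultimately have "card {h' \<in> d_subsets n d. h' \<inter> h = S} \<le> card (d_subsets n (d - card S))"
    by (rule card_inj_on_le[OF _ _ finite_d_subsets])
  also have "\<dots> \<le> n ^ (d - card S)"
    unfolding card_d_subsets
    by (cases "d - card S \<le> n") (auto intro: binomial_le_pow simp: binomial_eq_0)
  finally show ?thesis .
qed

text \<open>Hyperedges chosen for different traces are different, so a choice uses exactly
  \<open>card F\<close> hyperedges and all of them are present with probability
  \<open>p ^ card F\<close>.\<close>

lemma sum_traces_le:
  assumes h: "h \<in> d_subsets n d" and p: "0 \<le> p" "p \<le> 1" and F: "F \<in> pair_covers h"
  shows "(\<Sum>\<phi>\<in>traces n d h F. subset_mean (d_subsets n d) p (\<lambda>H. of_bool (\<phi> ` F \<subseteq> H)))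
    \<le> (\<Prod>S\<in>F. p * real n ^ (d - card S))"
proof -
  have fin: "finite F" using F h finite_subset[of F "Pow h"]
    by (auto simp: pair_covers_def dest!: d_subsetsD)
  have "(\<Sum>\<phi>\<in>traces n d h F. subset_mean (d_subsets n d) p (\<lambda>H. of_bool (\<phi> ` F \<subseteq> H)))
    = (\<Sum>\<phi>\<in>traces n d h F. p ^ card F)"
  proof (intro sum.cong refl)
    fix \<phi> assume \<phi>: "\<phi> \<in> traces n d h F"
    have \<phi>S: "\<phi> S \<in> d_subsets n d \<and> \<phi> S \<inter> h = S" if "S \<in> F" for S
      using PiE_mem[OF \<phi>[unfolded traces_def] that] by simp
    have "inj_on \<phi> F"
      using \<phi>S by (intro inj_onI) metis
    moreover have "\<phi> ` F \<subseteq> d_subsets n d"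
      using \<phi>S by (intro image_subsetI) simp
    ultimately show "subset_mean (d_subsets n d) p (\<lambda>H. of_bool (\<phi> ` F \<subseteq> H)) = p ^ card F"
      using subset_mean_superset[OF finite_d_subsets, of "\<phi> ` F" n d p] by (simp add: card_image)
  qed
  also have "\<dots> = (\<Prod>S\<in>F. p * real (card {h' \<in> d_subsets n d. h' \<inter> h = S}))"
    by (simp add: traces_def card_PiE fin prod.distrib)
  also have "\<dots> \<le> (\<Prod>S\<in>F. p * real n ^ (d - card S))"
  proof (intro prod_mono conjI mult_left_mono)
    fix S assume "S \<in> F"
    then have "card {h' \<in> d_subsets n d. h' \<inter> h = S} \<le> n ^ (d - card S)"
      using F h by (intro card_trace_le) (auto simp: pair_covers_def dest: d_subsetsD)
    then show "real (card {h' \<in> d_subsets n d. h' \<inter> h = S}) \<le> real n ^ (d - card S)"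
      by (simp flip: of_nat_power)
  qed (use p in auto)
  finally show ?thesis .
qed

text \<open>Union bound over the covers and over the choices of hyperedges.\<close>

lemma subset_mean_covers_le:
  assumes h: "h \<in> d_subsets n d" and p: "0 \<le> p" "p \<le> 1" and F: "\<F> \<subseteq> pair_covers h"
  shows "subset_mean (d_subsets n d) p
      (\<lambda>H. of_bool (\<exists>F\<in>\<F>. \<exists>\<phi>\<in>traces n d h F. \<phi> ` F \<subseteq> H))
    \<le> (\<Sum>F\<in>\<F>. \<Prod>S\<in>F. p * real n ^ (d - card S))"
proof -
  have fin\<F>: "finite \<F>" using F finite_pair_covers h finite_subset d_subsetsD by metis
  have fin: "finite (traces n d h F)" if "F \<in> \<F>" for F
  proof -
    have "finite F" using that F h finite_subset[of F "Pow h"]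
      by (auto simp: pair_covers_def dest!: d_subsetsD)
    then show ?thesis unfolding traces_def by (intro finite_PiE) (auto simp: finite_d_subsets)
  qed
  have "subset_mean (d_subsets n d) p
      (\<lambda>H. of_bool (\<exists>F\<in>\<F>. \<exists>\<phi>\<in>traces n d h F. \<phi> ` F \<subseteq> H))
    \<le> subset_mean (d_subsets n d) p (\<lambda>H. \<Sum>F\<in>\<F>. \<Sum>\<phi>\<in>traces n d h F. of_bool (\<phi> ` F \<subseteq> H))"
  proof (intro subset_mean_mono p)
    fix H
    show "of_bool (\<exists>F\<in>\<F>. \<exists>\<phi>\<in>traces n d h F. \<phi> ` F \<subseteq> H)
      \<le> (\<Sum>F\<in>\<F>. \<Sum>\<phi>\<in>traces n d h F. of_bool (\<phi> ` F \<subseteq> H) :: real)"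
    proof (cases "\<exists>F\<in>\<F>. \<exists>\<phi>\<in>traces n d h F. \<phi> ` F \<subseteq> H")
      case True
      then obtain F \<phi> where *: "F \<in> \<F>" "\<phi> \<in> traces n d h F" "\<phi> ` F \<subseteq> H" by auto
      have "(1::real) = of_bool (\<phi> ` F \<subseteq> H)" using * by simp
      also have "\<dots> \<le> (\<Sum>\<phi>\<in>traces n d h F. of_bool (\<phi> ` F \<subseteq> H))"
        using * fin by (intro member_le_sum) auto
      also have "\<dots> \<le> (\<Sum>F\<in>\<F>. \<Sum>\<phi>\<in>traces n d h F. of_bool (\<phi> ` F \<subseteq> H))"
        using * fin\<F> by (intro member_le_sum[of F \<F> "\<lambda>F. \<Sum>\<phi>\<in>traces n d h F. of_bool (\<phi> ` F \<subseteq> H)"] sum_nonneg) auto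
      finally show ?thesis using True by simp
    qed (simp add: sum_nonneg)
  qed
  also have "\<dots> = (\<Sum>F\<in>\<F>. \<Sum>\<phi>\<in>traces n d h F.
      subset_mean (d_subsets n d) p (\<lambda>H. of_bool (\<phi> ` F \<subseteq> H)))"
    by (simp add: subset_mean_sum)
  also have "\<dots> \<le> (\<Sum>F\<in>\<F>. \<Prod>S\<in>F. p * real n ^ (d - card S))"
    using h p F by (intro sum_mono sum_traces_le) auto
  finally show ?thesis .
qed

section \<open>Probability weights and exponents of covers\<close>

lemma real_choose_two: "real (s choose 2) = real s * (real s - 1) / 2"
proof (induction s)
  case (Suc s)
  have "Suc s choose 2 = s + (s choose 2)"
    using binomial_Suc_Suc[of s 1] by (simp add: numeral_2_eq_2)
  with Suc show ?case by (simp add: field_simps)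
qed simp

lemma pair_coversD:
  assumes "finite h" "F \<in> pair_covers h"
  shows "finite F" "card F \<le> 2 ^ card h" "S \<in> F \<Longrightarrow> S \<subseteq> h \<and> 2 \<le> card S \<and> card S \<le> card h"
proof -
  have F: "F \<subseteq> Pow h" using assms by (auto simp: pair_covers_def)
  show "finite F" using F assms finite_subset by blast
  show "card F \<le> 2 ^ card h" using card_mono[OF _ F] assms by (simp add: card_Pow)
  show "S \<in> F \<Longrightarrow> S \<subseteq> h \<and> 2 \<le> card S \<and> card S \<le> card h"
    using assms by (auto simp: pair_covers_def intro: card_mono)
qed

text \<open>A trace of size \<open>s\<close> contributes at most
  \<open>K * n powr (1 + \<delta> - s)\<close>, and exponents add up over \<open>F\<close>. The
  constant is made uniform by \<open>K \<ge> 1\<close> and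
  \<open>card F \<le> 2 ^ d\<close>.\<close>

lemma cover_weight_le:
  assumes h: "h \<in> d_subsets n d" and n: "n \<ge> 1" and K: "K \<ge> 1"
    and p: "0 \<le> p" "p \<le> K * real n powr (- real d + 1 + \<delta>)"
    and F: "F \<in> pair_covers h" and \<theta>: "\<theta> \<le> (\<Sum>S\<in>F. real (card S) - 1 - \<delta>)"
  shows "(\<Prod>S\<in>F. p * real n ^ (d - card S)) \<le> K ^ 2 ^ d * real n powr (- \<theta>)"
proof -
  have hfin: "finite h" "card h = d" using d_subsetsD[OF h] by auto
  note FD = pair_coversD[OF hfin(1) F]
  have "(\<Prod>S\<in>F. p * real n ^ (d - card S)) \<le> (\<Prod>S\<in>F. K * real n powr (- (real (card S) - 1 - \<delta>)))"
  proof (intro prod_mono conjI)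
    fix S assume S: "S \<in> F"
    have "p * real n ^ (d - card S) = p * real n powr (real d - real (card S))"
      using n FD(3)[OF S] hfin by (simp add: powr_realpow[symmetric] of_nat_diff)
    also have "\<dots> \<le> K * real n powr (- real d + 1 + \<delta>) * real n powr (real d - real (card S))"
      using p by (intro mult_right_mono) auto
    also have "\<dots> = K * real n powr (- (real (card S) - 1 - \<delta>))"
      by (simp add: mult.assoc algebra_simps flip: powr_add)
    finally show "p * real n ^ (d - card S) \<le> K * real n powr (- (real (card S) - 1 - \<delta>))" .
  qed (use p in auto)
  also have "\<dots> = K ^ card F * real n powr (- (\<Sum>S\<in>F. real (card S) - 1 - \<delta>))"
    using n FD(1) by (simp add: prod.distrib powr_sum[symmetric] sum_negf[symmetric])
  also have "\<dots> \<le> K ^ 2 ^ d * real n powr (- \<theta>)"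
    using n K FD(2) hfin \<theta> by (intro mult_mono power_increasing powr_mono) auto
  finally show ?thesis .
qed

lemma subset_mean_covers_powr_le:
  assumes h: "h \<in> d_subsets n d" and n: "n \<ge> 1" and K: "K \<ge> 1"
    and p: "0 \<le> p" "p \<le> 1" "p \<le> K * real n powr (- real d + 1 + \<delta>)"
    and F: "\<F> \<subseteq> pair_covers h"
    and \<theta>: "\<And>F. F \<in> \<F> \<Longrightarrow> \<theta> \<le> (\<Sum>S\<in>F. real (card S) - 1 - \<delta>)"
  shows "subset_mean (d_subsets n d) p
      (\<lambda>H. of_bool (\<exists>F\<in>\<F>. \<exists>\<phi>\<in>traces n d h F. \<phi> ` F \<subseteq> H))
    \<le> 2 ^ 2 ^ d * K ^ 2 ^ d * real n powr (- \<theta>)"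
proof -
  have hfin: "finite h" "card h = d" using d_subsetsD[OF h] by auto
  have "card \<F> \<le> 2 ^ 2 ^ d"
    using card_mono[OF finite_pair_covers[OF hfin(1)] F] card_pair_covers_le[OF hfin(1)] hfin(2) by simp
  then have c: "real (card \<F>) \<le> 2 ^ 2 ^ d"
    using of_nat_mono[of "card \<F>" "2 ^ 2 ^ d", where 'a = real] by simp
  have "subset_mean (d_subsets n d) p (\<lambda>H. of_bool (\<exists>F\<in>\<F>. \<exists>\<phi>\<in>traces n d h F. \<phi> ` F \<subseteq> H))
    \<le> (\<Sum>F\<in>\<F>. \<Prod>S\<in>F. p * real n ^ (d - card S))"
    by (rule subset_mean_covers_le[OF h p(1,2) F])
  also have "\<dots> \<le> (\<Sum>F\<in>\<F>. K ^ 2 ^ d * real n powr (- \<theta>))"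
    using F \<theta> by (intro sum_mono cover_weight_le[OF h n K p(1,3)]) auto
  also have "\<dots> = real (card \<F>) * (K ^ 2 ^ d * real n powr (- \<theta>))" by simp
  also have "\<dots> \<le> 2 ^ 2 ^ d * (K ^ 2 ^ d * real n powr (- \<theta>))"
    using K by (intro mult_right_mono c) auto
  finally show ?thesis by (simp add: mult.assoc)
qed

text \<open>A single proper subset of \<open>h\<close> misses some vertex \<open>x\<close>, and with
  it every pair \<open>{x, y}\<close>. This supplies the strict gain in
  \<open>sum_cover_subcritical\<close>.\<close>

lemma cover_two_le_card:
  assumes h: "finite h" "card h \<ge> 2" and F: "F \<in> pair_covers h" "h \<notin> F"
  shows "card F \<ge> 2"
proof (rule ccontr)
  assume "\<not> card F \<ge> 2"
  then have "card F = 0 \<or> card F = 1" by linarith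
  then have "\<exists>S. F \<subseteq> {S} \<and> S \<subseteq> h \<and> S \<noteq> h"
  proof
    assume "card F = 0"
    then have "F = {}" using pair_coversD(1)[OF h(1) F(1)] by simp
    then show ?thesis using h by (intro exI[of _ "{}"]) auto
  next
    assume "card F = 1"
    then obtain S where "F = {S}" using card_1_singletonE by blast
    then show ?thesis using F pair_coversD(3)[OF h(1) F(1), of S] by auto
  qed
  then obtain S where S: "F \<subseteq> {S}" "S \<subseteq> h" "S \<noteq> h" by blast
  then obtain x where x: "x \<in> h" "x \<notin> S" by blast
  have "\<exists>y\<in>h. y \<noteq> x"
  proof (rule ccontr)
    assume "\<not> (\<exists>y\<in>h. y \<noteq> x)"
    then have "h \<subseteq> {x}" by auto
    then have "card h \<le> 1" using card_mono[of "{x}" h] by simp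
    then show False using h by simp
  qed
  then obtain y where y: "y \<in> h" "y \<noteq> x" by blast
  have "{x, y} \<in> (\<Union>S\<in>F. Pow S)"
  proof -
    have "{x, y} \<in> {e. e \<subseteq> h \<and> card e = 2}" using x y by simp
    moreover have "{e. e \<subseteq> h \<and> card e = 2} \<subseteq> (\<Union>S\<in>F. Pow S)"
      using F(1) unfolding pair_covers_def by simp
    ultimately show ?thesis by (rule rev_subsetD)
  qed
  then show False using S x by auto
qed

text \<open>
  At \<open>\<delta>\<^sup>* = (d - 1) / (d + 1)\<close> the parabola \<open>(s choose 2) * 2 / (d + 1)\<close> meets the
  line \<open>s - 1 - \<delta>\<^sup>*\<close> at \<open>s = 2\<close> and \<open>s = d\<close>: covering a \<open>d\<close>-set by its pairs
  costs as much as the \<open>d\<close>-set itself, and no cover is cheaper.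
\<close>
lemma choose_two_le_line:
  assumes "2 \<le> s" "s \<le> d"
  shows "real (s choose 2) * 2 / (real d + 1) \<le> real s - 1 - (real d - 1) / (real d + 1)"
proof -
  have "0 \<le> (real s - 2) * (real d - real s)" using assms by (intro mult_nonneg_nonneg) auto
  then have "real s * (real s - 1) \<le> (real s - 1) * (real d + 1) - (real d - 1)"
    by (simp add: algebra_simps)
  then have "real s * (real s - 1) / (real d + 1) \<le> ((real s - 1) * (real d + 1) - (real d - 1)) / (real d + 1)"
    by (intro divide_right_mono) auto
  also have "\<dots> = real s - 1 - (real d - 1) / (real d + 1)"
    by (simp add: diff_divide_distrib)
  finally show ?thesis by (simp add: real_choose_two)
qed

text \<open>At the critical value the sum is at least the exponent of \<open>h\<close>, by
  \<open>choose_two_le_line\<close> and counting pairs. Decreasing the parameter to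
  \<open>\<delta>\<close> adds the gap once to the exponent of \<open>h\<close>, but once per member
  to the sum, hence at least twice.\<close>

lemma sum_cover_subcritical:
  assumes h: "finite h" "card h = d" "d \<ge> 2" and F: "F \<in> pair_covers h" "h \<notin> F"
    and \<delta>: "\<delta> \<le> (real d - 1) / (real d + 1)"
  shows "real d - 1 - \<delta> + ((real d - 1) / (real d + 1) - \<delta>) \<le> (\<Sum>S\<in>F. real (card S) - 1 - \<delta>)"
proof -
  define \<gamma> where "\<gamma> = (real d - 1) / (real d + 1)"
  note FD = pair_coversD[OF h(1) F(1)]
  have "real d - 1 - \<gamma> = real (d choose 2) * 2 / (real d + 1)"
    by (simp add: \<gamma>_def real_choose_two field_simps)
  also have "\<dots> \<le> real (\<Sum>S\<in>F. card S choose 2) * 2 / (real d + 1)"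
    using pair_covers_choose_le[OF h(1) F(1)] h(2) by (intro divide_right_mono mult_right_mono of_nat_mono) auto
  also have "\<dots> = (\<Sum>S\<in>F. real (card S choose 2) * 2 / (real d + 1))"
    by (simp add: sum_distrib_right sum_divide_distrib)
  also have "\<dots> \<le> (\<Sum>S\<in>F. real (card S) - 1 - \<gamma>)"
    unfolding \<gamma>_def using FD(3) h by (intro sum_mono choose_two_le_line) auto
  finally have 1: "real d - 1 - \<gamma> \<le> (\<Sum>S\<in>F. real (card S) - 1 - \<gamma>)" .
  have "2 * (\<gamma> - \<delta>) \<le> real (card F) * (\<gamma> - \<delta>)"
    using cover_two_le_card[OF h(1) _ F] h \<delta> by (intro mult_right_mono) (auto simp: \<gamma>_def)
  moreover have "(\<Sum>S\<in>F. real (card S) - 1 - \<delta>) = (\<Sum>S\<in>F. real (card S) - 1 - \<gamma>) + real (card F) * (\<gamma> - \<delta>)"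
    by (simp add: sum_subtractf sum.distrib algebra_simps)
  ultimately have "real d - 1 - \<gamma> + 2 * (\<gamma> - \<delta>) \<le> (\<Sum>S\<in>F. real (card S) - 1 - \<delta>)"
    using 1 by (metis add_mono)
  then show ?thesis unfolding \<gamma>_def[symmetric] by simp
qed

text \<open>Replacing a trace of size \<open>s\<close> by its pairs does not raise the exponent:
  twice the difference is \<open>(s - 2) * (2 - (1 - \<delta>) * (s + 1))\<close>, nonnegative
  because \<open>(1 - \<delta>) * (d + 1) \<le> 2\<close>.\<close>

lemma sum_cover_supercritical:
  assumes h: "finite h" "card h = d" and F: "F \<in> pair_covers h"
    and \<delta>: "(real d - 1) / (real d + 1) \<le> \<delta>" "\<delta> \<le> 1"
  shows "real (d choose 2) * (1 - \<delta>) \<le> (\<Sum>S\<in>F. real (card S) - 1 - \<delta>)"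
proof -
  note FD = pair_coversD[OF h(1) F]
  have "real (d choose 2) * (1 - \<delta>) \<le> real (\<Sum>S\<in>F. card S choose 2) * (1 - \<delta>)"
    using pair_covers_choose_le[OF h(1) F(1)] h(2) \<delta> by (intro mult_right_mono of_nat_mono) auto
  also have "\<dots> = (\<Sum>S\<in>F. real (card S choose 2) * (1 - \<delta>))"
    by (simp add: sum_distrib_right)
  also have "\<dots> \<le> (\<Sum>S\<in>F. real (card S) - 1 - \<delta>)"
  proof (intro sum_mono)
    fix S assume "S \<in> F"
    then have s: "2 \<le> card S" "card S \<le> d" using FD(3) h by auto
    have "(real d - 1) \<le> \<delta> * (real d + 1)" using \<delta>(1) by (simp add: field_simps)
    then have "(1 - \<delta>) * (real d + 1) \<le> 2" by (simp add: algebra_simps)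
    moreover have "(1 - \<delta>) * (real (card S) + 1) \<le> (1 - \<delta>) * (real d + 1)"
      using s \<delta> by (intro mult_left_mono) auto
    ultimately have "0 \<le> (real (card S) - 2) * (2 - (1 - \<delta>) * (real (card S) + 1))"
      using s by (intro mult_nonneg_nonneg) auto
    then show "real (card S choose 2) * (1 - \<delta>) \<le> real (card S) - 1 - \<delta>"
      by (simp add: real_choose_two field_simps)
  qed
  finally show ?thesis .
qed

section \<open>Expected numbers of cliques and of false cliques\<close>

lemma subset_mean_card_eq_sum:
  assumes "\<And>H. H \<subseteq> d_subsets n d \<Longrightarrow> A H \<subseteq> d_subsets n d"
  shows "subset_mean (d_subsets n d) p (\<lambda>H. real (card (A H)))
    = (\<Sum>h\<in>d_subsets n d. subset_mean (d_subsets n d) p (\<lambda>H. of_bool (h \<in> A H)))"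
proof -
  have "real (card (A H)) = (\<Sum>h\<in>d_subsets n d. of_bool (h \<in> A H))" if "H \<subseteq> d_subsets n d" for H
  proof -
    have "d_subsets n d \<inter> {h. h \<in> A H} = A H" using assms[OF that] by blast
    then show ?thesis by (simp add: of_bool_def sum.If_cases finite_d_subsets)
  qed
  then show ?thesis
    unfolding subset_mean_sum[symmetric] by (rule subset_mean_cong)
qed

text \<open>A false clique is witnessed by a cover avoiding \<open>h\<close>. The bound per
  \<open>d\<close>-set is thus smaller than the order of \<open>p\<close> by the power of
  \<open>n\<close> given by the distance from the threshold.\<close>

lemma mean_false_cliques_le:
  assumes d: "d \<ge> 2" and n: "n \<ge> 1" and K: "K \<ge> 1"
    and p: "0 \<le> p" "p \<le> 1" "p \<le> K * real n powr (- real d + 1 + \<delta>)"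
    and \<delta>: "\<delta> \<le> (real d - 1) / (real d + 1)"
  shows "subset_mean (d_subsets n d) p (\<lambda>H. real (card (cliques n d (Proj H) - H)))
    \<le> real (n choose d) * (2 ^ 2 ^ d * K ^ 2 ^ d * real n powr
        (- (real d - 1 - \<delta> + ((real d - 1) / (real d + 1) - \<delta>))))"
    (is "?L \<le> _ * ?R")
proof -
  have "?L = (\<Sum>h\<in>d_subsets n d. subset_mean (d_subsets n d) p (\<lambda>H. of_bool (h \<in> cliques n d (Proj H) - H)))"
    using cliques_subset by (intro subset_mean_card_eq_sum) blast
  also have "\<dots> \<le> (\<Sum>h\<in>d_subsets n d. ?R)"
  proof (intro sum_mono)
    fix h assume h: "h \<in> d_subsets n d"
    define \<F> where "\<F> = {F \<in> pair_covers h. h \<notin> F}"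
    have "subset_mean (d_subsets n d) p (\<lambda>H. of_bool (h \<in> cliques n d (Proj H) - H))
      \<le> subset_mean (d_subsets n d) p (\<lambda>H. of_bool (\<exists>F\<in>\<F>. \<exists>\<phi>\<in>traces n d h F. \<phi> ` F \<subseteq> H))"
    proof (intro subset_mean_mono p)
      fix H assume H: "H \<subseteq> d_subsets n d"
      have "\<exists>F\<in>\<F>. \<exists>\<phi>\<in>traces n d h F. \<phi> ` F \<subseteq> H" if "h \<in> cliques n d (Proj H) - H"
      proof -
        have "h \<in> cliques n d (Proj H)" "h \<notin> H" using that by auto
        then obtain F \<phi> where "F \<in> pair_covers h" "\<phi> \<in> traces n d h F" "\<phi> ` F \<subseteq> H" "h \<notin> F"
          using clique_Proj_traces[OF H] by metis
        then show ?thesis unfolding \<F>_def by auto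
      qed
      then show "of_bool (h \<in> cliques n d (Proj H) - H)
        \<le> (of_bool (\<exists>F\<in>\<F>. \<exists>\<phi>\<in>traces n d h F. \<phi> ` F \<subseteq> H) :: real)" by simp
    qed
    also have "\<dots> \<le> ?R"
      using d_subsetsD[OF h] d \<delta>
      by (intro subset_mean_covers_powr_le[OF h n K p] sum_cover_subcritical) (auto simp: \<F>_def)
    finally show "subset_mean (d_subsets n d) p (\<lambda>H. of_bool (h \<in> cliques n d (Proj H) - H)) \<le> ?R" .
  qed
  finally show ?thesis by (simp add: card_d_subsets)
qed

lemma mean_cliques_le:
  assumes n: "n \<ge> 1" and K: "K \<ge> 1"
    and p: "0 \<le> p" "p \<le> 1" "p \<le> K * real n powr (- real d + 1 + \<delta>)"
    and \<delta>: "(real d - 1) / (real d + 1) \<le> \<delta>"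
  shows "subset_mean (d_subsets n d) p (\<lambda>H. real (card (cliques n d (Proj H))))
    \<le> real (n choose d) * (2 ^ 2 ^ d * K ^ 2 ^ d * real n powr (- (real (d choose 2) * max 0 (1 - \<delta>))))"
    (is "?L \<le> _ * ?R")
proof -
  have "?L = (\<Sum>h\<in>d_subsets n d. subset_mean (d_subsets n d) p (\<lambda>H. of_bool (h \<in> cliques n d (Proj H))))"
    using cliques_subset by (intro subset_mean_card_eq_sum) blast
  also have "\<dots> \<le> (\<Sum>h\<in>d_subsets n d. ?R)"
  proof (intro sum_mono)
    fix h assume h: "h \<in> d_subsets n d"
    show "subset_mean (d_subsets n d) p (\<lambda>H. of_bool (h \<in> cliques n d (Proj H))) \<le> ?R"
    proof (cases "\<delta> \<le> 1")
      case True
      have "subset_mean (d_subsets n d) p (\<lambda>H. of_bool (h \<in> cliques n d (Proj H)))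
        \<le> subset_mean (d_subsets n d) p (\<lambda>H. of_bool (\<exists>F\<in>pair_covers h. \<exists>\<phi>\<in>traces n d h F. \<phi> ` F \<subseteq> H))"
      proof (intro subset_mean_mono p)
        fix H assume H: "H \<subseteq> d_subsets n d"
        have "\<exists>F\<in>pair_covers h. \<exists>\<phi>\<in>traces n d h F. \<phi> ` F \<subseteq> H" if "h \<in> cliques n d (Proj H)"
          using clique_Proj_traces[OF H that] by metis
        then show "of_bool (h \<in> cliques n d (Proj H))
          \<le> (of_bool (\<exists>F\<in>pair_covers h. \<exists>\<phi>\<in>traces n d h F. \<phi> ` F \<subseteq> H) :: real)" by simp
      qed
      also have "\<dots> \<le> 2 ^ 2 ^ d * K ^ 2 ^ d * real n powr (- (real (d choose 2) * (1 - \<delta>)))"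
        using d_subsetsD[OF h] \<delta> True
        by (intro subset_mean_covers_powr_le[OF h n K p] sum_cover_supercritical) auto
      finally show ?thesis using True by (simp add: max_def)
    next
      case False
      have "subset_mean (d_subsets n d) p (\<lambda>H. of_bool (h \<in> cliques n d (Proj H)))
        \<le> subset_mean (d_subsets n d) p (\<lambda>_. 1)"
        using p by (intro subset_mean_mono) auto
      also have "\<dots> \<le> 2 ^ 2 ^ d * K ^ 2 ^ d"
        using K mult_mono[of 1 "2 ^ 2 ^ d" 1 "K ^ 2 ^ d"]
        by (simp add: subset_mean_const finite_d_subsets)
      finally show ?thesis using False n by (simp add: max_def)
    qed
  qed
  finally show ?thesis by (simp add: card_d_subsets)
qed

subsection \<open>Losses of estimators\<close>

lemma estimatorD:
  assumes "B \<in> estimators n d" "H \<subseteq> d_subsets n d"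
  shows "B (Proj H) \<subseteq> d_subsets n d"
proof -
  have "Proj H \<in> projected_graphs n d" using assms(2) by (auto simp: projected_graphs_def)
  from PiE_mem[OF assms(1)[unfolded estimators_def] this] show ?thesis by simp
qed

lemma loss_eq:
  assumes p: "0 \<le> p" "p \<le> 1" and B: "B \<in> estimators n d"
  shows "loss n d p B =
    (subset_mean (d_subsets n d) p (\<lambda>H. real (card (B (Proj H) - H)))
      + subset_mean (d_subsets n d) p (\<lambda>H. real (card (H - B (Proj H)))))
    / (p * real (n choose d))"
proof -
  have "real (card (sym_diff (B (Proj H)) H)) = real (card (B (Proj H) - H)) + real (card (H - B (Proj H)))"
    if H: "H \<subseteq> d_subsets n d" for H
  proof -
    have "finite (B (Proj H))" "finite H"
      using estimatorD[OF B H] H finite_d_subsets finite_subset by blast+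
    then have "card (sym_diff (B (Proj H)) H) = card (B (Proj H) - H) + card (H - B (Proj H))"
      by (intro card_Un_disjoint) auto
    then show ?thesis by simp
  qed
  then show ?thesis
    unfolding loss_def expectation_random_hypergraph[OF p] subset_mean_add[symmetric]
    by (intro arg_cong2[where f = "(/)"] subset_mean_cong refl) simp
qed

lemma partial_recovery_loss_le_loss:
  "B \<in> estimators n d \<Longrightarrow> partial_recovery_loss n d p \<le> loss n d p B"
  unfolding partial_recovery_loss_def by (intro Min_le) (auto simp: finite_estimators)

lemma partial_recovery_loss_geI:
  "(\<And>B. B \<in> estimators n d \<Longrightarrow> x \<le> loss n d p B) \<Longrightarrow> x \<le> partial_recovery_loss n d p"
  unfolding partial_recovery_loss_def
  by (subst Min_ge_iff) (auto simp: finite_estimators estimators_nonempty)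

lemma partial_recovery_loss_nonneg:
  "0 \<le> p \<Longrightarrow> 0 \<le> partial_recovery_loss n d p"
  by (intro partial_recovery_loss_geI) (simp add: loss_def)

text \<open>The estimator that always answers the empty set errs exactly on the hyperedges.\<close>

lemma partial_recovery_loss_le_1:
  assumes p: "0 < p" "p \<le> 1"
  shows "partial_recovery_loss n d p \<le> 1"
proof -
  define B where "B = (\<lambda>G\<in>projected_graphs n d. {} :: nat set set)"
  have B: "B \<in> estimators n d" by (auto simp: B_def estimators_def)
  have "B (Proj H) = {}" if "H \<subseteq> d_subsets n d" for H
    using that by (auto simp: B_def projected_graphs_def)
  then have "loss n d p B = (subset_mean (d_subsets n d) p (\<lambda>_. 0)
      + subset_mean (d_subsets n d) p (\<lambda>H. real (card H))) / (p * real (n choose d))"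
    unfolding loss_eq[OF less_imp_le[OF p(1)] p(2) B]
    by (intro arg_cong2[where f = "(/)"] arg_cong2[where f = "(+)"] subset_mean_cong refl) simp_all
  also have "\<dots> \<le> 1"
    by (simp add: subset_mean_const subset_mean_card finite_d_subsets card_d_subsets)
  finally show ?thesis using partial_recovery_loss_le_loss[OF B, of p] by linarith
qed

section \<open>Upper bound on the loss below the threshold\<close>

text \<open>Returning all cliques misses no hyperedge, so only false cliques contribute; their
  expected number is divided by \<open>p * (n choose d)\<close>.\<close>

lemma partial_recovery_loss_le_powr:
  assumes d: "d \<ge> 2" and n: "n \<ge> 1" and K: "K \<ge> 1" and k: "k > 0"
    and p: "p \<le> 1" "k * real n powr (- real d + 1 + \<delta>) \<le> p" "p \<le> K * real n powr (- real d + 1 + \<delta>)"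
    and \<delta>: "\<delta> \<le> (real d - 1) / (real d + 1)"
  shows "partial_recovery_loss n d p
    \<le> 2 ^ 2 ^ d * K ^ 2 ^ d / k * real n powr (- ((real d - 1) / (real d + 1) - \<delta>))"
proof -
  define \<gamma> where "\<gamma> = (real d - 1) / (real d + 1) - \<delta>"
  define A where "A = 2 ^ 2 ^ d * K ^ 2 ^ d"
  have A: "A > 0" using K by (simp add: A_def)
  have "0 < k * real n powr (- real d + 1 + \<delta>)" using k n by simp
  then have p0: "p > 0" using p by linarith
  define B where "B = (\<lambda>G\<in>projected_graphs n d. cliques n d G)"
  have B: "B \<in> estimators n d" using cliques_subset by (auto simp: B_def estimators_def)
  have BP: "B (Proj H) = cliques n d (Proj H)" if "H \<subseteq> d_subsets n d" for H
    using that by (auto simp: B_def projected_graphs_def)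
  have "loss n d p B = (subset_mean (d_subsets n d) p (\<lambda>H. real (card (cliques n d (Proj H) - H)))
      + subset_mean (d_subsets n d) p (\<lambda>H. 0)) / (p * real (n choose d))"
    unfolding loss_eq[OF less_imp_le[OF p0] p(1) B]
    using subset_cliques_Proj BP
    by (intro arg_cong2[where f = "(/)"] arg_cong2[where f = "(+)"] subset_mean_cong refl)
      (simp_all add: Diff_eq_empty_iff[THEN iffD2])
  also have "\<dots> \<le> (real (n choose d) * (A * real n powr (- (real d - 1 - \<delta> + \<gamma>)))) / (p * real (n choose d))"
    using mean_false_cliques_le[OF d n K less_imp_le[OF p0] p(1,3) \<delta>] p0
    by (intro divide_right_mono) (simp_all add: subset_mean_const finite_d_subsets \<gamma>_def A_def)
  also have "\<dots> \<le> A * real n powr (- (real d - 1 - \<delta> + \<gamma>)) / p"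
    using p0 A by (cases "n choose d = 0") auto
  also have "\<dots> \<le> A * real n powr (- (real d - 1 - \<delta> + \<gamma>)) / (k * real n powr (- real d + 1 + \<delta>))"
    using p p0 A k n by (intro divide_left_mono mult_pos_pos) auto
  also have "\<dots> = A / k * (real n powr (- (real d - 1 - \<delta> + \<gamma>)) / real n powr (- real d + 1 + \<delta>))"
    by simp
  also have "real n powr (- (real d - 1 - \<delta> + \<gamma>)) / real n powr (- real d + 1 + \<delta>) = real n powr (- \<gamma>)"
    by (simp flip: powr_diff)
  finally show ?thesis
    using partial_recovery_loss_le_loss[OF B, of p] by (simp add: A_def \<gamma>_def)
qed

section \<open>Lower bound on the loss above the threshold, by coding\<close>

text \<open>
  Gibbs' inequality for the weight that codes a hypergraph by its projection (an edge costs
  \<open>-ln q\<close>) followed by its hyperedges, given the projection \<open>G\<close>: a member of \<open>B G\<close> is taken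
  with probability \<open>1/2\<close>, any other clique of \<open>G\<close> with probability \<open>p / \<rho>\<close>.
\<close>
lemma coding_inequality:
  assumes p: "0 < p" "p < 1" and B: "B \<in> estimators n d"
    and \<rho>: "0 < \<rho>" "p / \<rho> \<le> 1 / 2" and q: "0 < q" "q \<le> 1 / 2"
  shows "subset_mean (d_subsets n d) p (\<lambda>H. real (card (H \<inter> B (Proj H)))) * ln (\<rho> / (2 * p))
      + p * real (n choose d) * ln (1 / \<rho>)
    \<le> real (d choose 2) * (p * real (n choose d)) * ln (1 / q) + 2 * q * real (n choose 2)
      + ln 2 * subset_mean (d_subsets n d) p (\<lambda>H. real (card (B (Proj H) - H)))
      + 2 * (p / \<rho>) * subset_mean (d_subsets n d) p (\<lambda>H. real (card (cliques n d (Proj H))))"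
proof -
  define E where "E = d_subsets n d"
  define V where "V = d_subsets n 2"
  define \<tau> where "\<tau> = p / \<rho>"
  define \<pi> where "\<pi> G h = (if h \<in> B G then 1 / 2 else if h \<in> cliques n d G then \<tau> else 0)" for G h
  define Q where "Q G = q ^ card G * (1 - q) ^ card (V - G)" for G :: "nat set set"
  define W where "W G H = (\<Prod>h\<in>H. \<pi> G h) * (\<Prod>h\<in>E - H. 1 - \<pi> G h)" for G H
  define R where "R H = Q (Proj H) * W (Proj H) H" for H
  have fin: "finite E" "finite V" by (simp_all add: E_def V_def finite_d_subsets)
  have \<tau>: "0 < \<tau>" "\<tau> \<le> 1 / 2" using p \<rho> by (simp_all add: \<tau>_def)
  have \<pi>: "0 \<le> \<pi> G h" "\<pi> G h \<le> 1 / 2" for G h using \<tau> by (auto simp: \<pi>_def)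
  have \<pi>1: "0 < 1 - \<pi> G h" for G h using \<pi>(2)[of G h] by simp
  have \<pi>0: "0 < \<pi> (Proj H) h" if "H \<subseteq> E" "h \<in> H" for H h
  proof -
    have "h \<in> cliques n d (Proj H)" using subset_cliques_Proj[of H n d] that by (auto simp: E_def)
    then show ?thesis using \<tau> by (simp add: \<pi>_def)
  qed
  have Q0: "0 < Q G" for G using q by (simp add: Q_def)
  have W0: "0 \<le> W G H" for G H
    unfolding W_def using \<pi> \<pi>1 by (intro mult_nonneg_nonneg prod_nonneg) (auto intro: less_imp_le)
  have Wpos: "0 < (\<Prod>h\<in>H. \<pi> (Proj H) h)" "0 < (\<Prod>h\<in>E - H. 1 - \<pi> (Proj H) h)" if "H \<subseteq> E" for H
    using \<pi>0[OF that] \<pi>1 by (auto intro!: prod_pos)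
  have Rpos: "0 < R H" if "H \<subseteq> E" for H
    unfolding R_def W_def using Wpos[OF that] Q0 by simp
  \<comment> \<open>Each \<open>H\<close> uses only its own projection; summing over all graphs
    \<open>G\<close> instead can only increase the total and decouples \<open>G\<close> from
    \<open>H\<close>.\<close>
  have "(\<Sum>H\<in>Pow E. R H) \<le> (\<Sum>H\<in>Pow E. \<Sum>G\<in>Pow V. Q G * W G H)"
  proof (intro sum_mono)
    fix H assume "H \<in> Pow E"
    then have "Proj H \<in> Pow V" using Proj_subset[of H n d] by (simp add: E_def V_def)
    moreover have "0 \<le> Q G * W G H" for G using Q0[of G] W0[of G H] by simp
    ultimately show "R H \<le> (\<Sum>G\<in>Pow V. Q G * W G H)"
      unfolding R_def using fin by (intro member_le_sum[of "Proj H" "Pow V" "\<lambda>G. Q G * W G H"]) auto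
  qed
  also have "\<dots> = (\<Sum>G\<in>Pow V. Q G * (\<Sum>H\<in>Pow E. W G H))"
    by (subst sum.swap) (simp add: sum_distrib_left)
  \<comment> \<open>For fixed \<open>G\<close>, \<open>W G\<close> is the law of independent choices
    with probabilities \<open>\<pi> G h\<close>, so it sums to 1.\<close>
  also have "\<dots> = (\<Sum>G\<in>Pow V. Q G)"
  proof -
    have "(\<Sum>H\<in>Pow E. W G H) = (\<Prod>h\<in>E. \<pi> G h + (1 - \<pi> G h))" for G
      unfolding W_def by (rule prod_add[OF fin(1), symmetric])
    then show ?thesis by simp
  qed
  also have "\<dots> = 1"
    using subset_mean_const[OF fin(2), of q 1] by (simp add: subset_mean_def Q_def)
  finally have Rsum: "(\<Sum>H\<in>Pow E. R H) \<le> 1" .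
  have pointwise: "real (card (H \<inter> B (Proj H))) * ln (\<rho> / (2 * p)) + real (card H) * ln (1 / \<rho>)
      - real (d choose 2) * real (card H) * ln (1 / q) - 2 * q * real (n choose 2)
      - ln 2 * real (card (B (Proj H) - H)) - 2 * \<tau> * real (card (cliques n d (Proj H)))
    \<le> ln (R H / (p ^ card H * (1 - p) ^ card (E - H)))" if H: "H \<subseteq> E" for H
  proof -
    define G where "G = Proj H"
    define C where "C = cliques n d G"
    have HC: "H \<subseteq> C" using subset_cliques_Proj[of H n d] H by (simp add: E_def C_def G_def)
    have CE: "C \<subseteq> E" using cliques_subset by (simp add: C_def E_def)
    have BE: "B G \<subseteq> E" using estimatorD[OF B, of H] H by (simp add: E_def G_def)
    have finH: "finite H" using H fin finite_subset by blast
    have l1: "ln (R H / (p ^ card H * (1 - p) ^ card (E - H)))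
      = ln (Q G) + (\<Sum>h\<in>H. ln (\<pi> G h)) + (\<Sum>h\<in>E - H. ln (1 - \<pi> G h))
        - real (card H) * ln p - real (card (E - H)) * ln (1 - p)"
    proof -
      have "ln (R H / (p ^ card H * (1 - p) ^ card (E - H)))
        = ln (Q G) + (ln (\<Prod>h\<in>H. \<pi> G h) + ln (\<Prod>h\<in>E - H. 1 - \<pi> G h))
          - (ln (p ^ card H) + ln ((1 - p) ^ card (E - H)))"
        using Wpos[OF H] Q0[of G] p unfolding R_def W_def G_def
        by (simp add: ln_div ln_mult)
      moreover have "ln (\<Prod>h\<in>H. \<pi> G h) = (\<Sum>h\<in>H. ln (\<pi> G h))"
        using \<pi>0[OF H, THEN less_imp_neq] finH by (intro ln_prod) (simp_all add: G_def)
      moreover have "ln (\<Prod>h\<in>E - H. 1 - \<pi> G h) = (\<Sum>h\<in>E - H. ln (1 - \<pi> G h))"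
        using \<pi>1[THEN less_imp_neq] fin by (intro ln_prod) simp_all
      ultimately show ?thesis using p by (simp add: ln_realpow)
    qed
    \<comment> \<open>A hyperedge costs \<open>- ln (p / \<rho>)\<close> as an ordinary clique;
      being in \<open>B G\<close> changes the probability to \<open>1 / 2\<close> and saves
      \<open>ln (\<rho> / (2 * p))\<close>.\<close>
    have l2: "(\<Sum>h\<in>H. ln (\<pi> G h)) = real (card (H \<inter> B G)) * ln (\<rho> / (2 * p)) + real (card H) * (ln p - ln \<rho>)"
    proof -
      have "(\<Sum>h\<in>H. ln (\<pi> G h)) = (\<Sum>h\<in>H. (if h \<in> B G then ln (\<rho> / (2 * p)) else 0) + (ln p - ln \<rho>))"
      proof (intro sum.cong refl)
        fix h assume "h \<in> H"
        then have "h \<in> cliques n d G" using HC by (auto simp: C_def)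
        then show "ln (\<pi> G h) = (if h \<in> B G then ln (\<rho> / (2 * p)) else 0) + (ln p - ln \<rho>)"
          using p \<rho> by (simp add: \<pi>_def \<tau>_def ln_div ln_mult)
      qed
      also have "\<dots> = real (card (H \<inter> B G)) * ln (\<rho> / (2 * p)) + real (card H) * (ln p - ln \<rho>)"
        using finH by (simp add: sum.distrib sum.If_cases)
      finally show ?thesis .
    qed
    \<comment> \<open>Rejecting a member of \<open>B G\<close> costs \<open>ln 2\<close>; rejecting
      another clique costs at most \<open>2 * \<tau>\<close>, as \<open>\<tau> \<le> 1 / 2\<close>;
      non-cliques outside \<open>B G\<close> are free.\<close>
    have l3: "- ln 2 * real (card (B G - H)) - 2 * \<tau> * real (card C) \<le> (\<Sum>h\<in>E - H. ln (1 - \<pi> G h))"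
    proof -
      have ln\<tau>: "- (2 * \<tau>) \<le> ln (1 - \<tau>)"
      proof -
        have "- \<tau> - 2 * \<tau>\<^sup>2 \<le> ln (1 - \<tau>)" using \<tau> by (intro ln_one_minus_pos_lower_bound) auto
        moreover have "2 * \<tau>\<^sup>2 \<le> \<tau>" using \<tau> by (simp add: power2_eq_square)
        ultimately show ?thesis by linarith
      qed
      have "(E - H) \<inter> {h. h \<in> B G} = B G - H" using BE by blast
      then have "- ln 2 * real (card (B G - H)) - 2 * \<tau> * real (card ((E - H) \<inter> C))
        = (\<Sum>h\<in>E - H. (if h \<in> B G then - ln 2 else 0) + (if h \<in> C then - (2 * \<tau>) else 0))"
        using fin by (simp add: sum.distrib sum.If_cases)
      also have "\<dots> \<le> (\<Sum>h\<in>E - H. ln (1 - \<pi> G h))"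
        using ln\<tau> \<tau> by (intro sum_mono) (auto simp: \<pi>_def C_def ln_div)
      finally have "- ln 2 * real (card (B G - H)) - 2 * \<tau> * real (card ((E - H) \<inter> C))
        \<le> (\<Sum>h\<in>E - H. ln (1 - \<pi> G h))" .
      moreover have "2 * \<tau> * real (card ((E - H) \<inter> C)) \<le> 2 * \<tau> * real (card C)"
        using \<tau> finite_subset[OF CE fin(1)] by (intro mult_left_mono of_nat_mono card_mono) auto
      ultimately show ?thesis by linarith
    qed
    \<comment> \<open>Every hyperedge creates at most \<open>d choose 2\<close> edges, each costing
      \<open>ln (1 / q)\<close>; a non-edge costs at most \<open>2 * q\<close>.\<close>
    have l4: "- real (d choose 2) * real (card H) * ln (1 / q) - 2 * q * real (n choose 2) \<le> ln (Q G)"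
    proof -
      have "real (card G) * ln (1 / q) \<le> real ((d choose 2) * card H) * ln (1 / q)"
        using card_Proj_le[of H n d] H q
        by (intro mult_right_mono of_nat_mono) (auto simp: G_def E_def)
      moreover have "real (card (V - G)) * (- (2 * q)) \<le> real (card (V - G)) * ln (1 - q)"
      proof (intro mult_left_mono)
        have "- q - 2 * q\<^sup>2 \<le> ln (1 - q)" using q by (intro ln_one_minus_pos_lower_bound) auto
        moreover have "2 * q\<^sup>2 \<le> q" using q by (simp add: power2_eq_square)
        ultimately show "- (2 * q) \<le> ln (1 - q)" by linarith
      qed simp
      moreover have "real (card (V - G)) * (2 * q) \<le> real (n choose 2) * (2 * q)"
        using q fin card_mono[of V "V - G"] by (intro mult_right_mono of_nat_mono) (auto simp: V_def card_d_subsets)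
      moreover have "ln (Q G) = - (real (card G) * ln (1 / q)) + real (card (V - G)) * ln (1 - q)"
        using q by (simp add: Q_def ln_mult ln_realpow ln_div)
      ultimately show ?thesis by (simp add: mult_ac)
    qed
    \<comment> \<open>The non-hyperedge factor of the true law only helps the inequality and is
      dropped.\<close>
    have "real (card (E - H)) * ln (1 - p) \<le> 0"
      using p by (intro mult_nonneg_nonpos) auto
    then show ?thesis
      using l1 l2 l3 l4 \<rho> unfolding G_def[symmetric] C_def[symmetric]
      by (simp add: ln_div algebra_simps)
  qed
  have "subset_mean E p (\<lambda>H. real (card (H \<inter> B (Proj H))) * ln (\<rho> / (2 * p)) + real (card H) * ln (1 / \<rho>)
      - real (d choose 2) * real (card H) * ln (1 / q) - 2 * q * real (n choose 2)
      - ln 2 * real (card (B (Proj H) - H)) - 2 * \<tau> * real (card (cliques n d (Proj H)))) \<le> 0"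
    (is "?M \<le> 0")
  proof -
    have "?M \<le> subset_mean E p (\<lambda>H. ln (R H / (p ^ card H * (1 - p) ^ card (E - H))))"
      using p pointwise by (intro subset_mean_mono) auto
    also have "\<dots> \<le> 0" by (intro subset_mean_gibbs fin p Rpos Rsum)
    finally show ?thesis .
  qed
  moreover have "?M = subset_mean E p (\<lambda>H. real (card (H \<inter> B (Proj H)))) * ln (\<rho> / (2 * p))
      + p * real (n choose d) * ln (1 / \<rho>)
      - real (d choose 2) * (p * real (n choose d)) * ln (1 / q) - 2 * q * real (n choose 2)
      - ln 2 * subset_mean E p (\<lambda>H. real (card (B (Proj H) - H)))
      - 2 * \<tau> * subset_mean E p (\<lambda>H. real (card (cliques n d (Proj H))))"
  proof -
    have cE: "real (n choose d) = real (card E)" by (simp add: E_def card_d_subsets)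
    have mc: "subset_mean E p (\<lambda>H. f H * a) = subset_mean E p f * a" for f a
      using subset_mean_cmult[of E p a f] by (simp add: mult.commute)
    show ?thesis
      unfolding subset_mean_diff subset_mean_add subset_mean_cmult mc cE
        subset_mean_card[OF fin(1)] subset_mean_const[OF fin(1)] by (rule refl)
  qed
  ultimately show ?thesis unfolding E_def \<tau>_def by linarith
qed

text \<open>From \<open>(n / d) ^ d \<le> n choose d\<close>. It lets the cost of coding the
  non-edges be absorbed into the expected number of hyperedges.\<close>

lemma mean_hyperedges_ge:
  assumes n: "n \<ge> d" "n \<ge> 1" and p: "k * real n powr (- real d + 1 + \<delta>) \<le> p" and k: "k \<ge> 0"
  shows "k * real n powr (1 + \<delta>) \<le> real d ^ d * (p * real (n choose d))"
proof -
  have e: "real n powr (1 + \<delta>) = real n powr (- real d + 1 + \<delta>) * real n ^ d"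
    using n by (simp flip: powr_add powr_realpow)
  have "(real n / real d) ^ d \<le> real (n choose d)"
    using binomial_ge_n_over_k_pow_k[OF n(1)] by simp
  then have "real n ^ d \<le> real d ^ d * real (n choose d)"
    by (cases "d = 0") (simp_all add: power_divide field_simps)
  then have "k * real n powr (- real d + 1 + \<delta>) * real n ^ d \<le> p * (real d ^ d * real (n choose d))"
    using p k by (intro mult_mono order_trans[OF _ p]) auto
  then show ?thesis by (simp add: e mult_ac)
qed

text \<open>\<open>coding_inequality\<close> with parameters for which the terms of order
  \<open>ln n\<close> per hyperedge in the cost of the projection and of the cliques cancel. Then
  only the saving on correct guesses still grows with \<open>n\<close>: \<open>\<eta>\<close> is the
  exponent of the ratio of the clique bound to \<open>p\<close>.\<close>

lemma partial_recovery_loss_ge: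
  assumes d: "d \<ge> 2" and n: "n \<ge> d" and K: "K \<ge> 1" and k: "k > 0"
    and p: "p < 1" "k * real n powr (- real d + 1 + \<delta>) \<le> p" "p \<le> K * real n powr (- real d + 1 + \<delta>)"
    and \<delta>: "(real d - 1) / (real d + 1) \<le> \<delta>"
    and \<eta>: "\<eta> = real d - 1 - \<delta> - real (d choose 2) * max 0 (1 - \<delta>)"
    and X: "0 < \<eta> * ln n - ln (4 * K)"
  shows "1 - (real (d choose 2) * ln 2 + real d ^ d / k + 2 * (2 ^ 2 ^ d * K ^ 2 ^ d)) / (\<eta> * ln n - ln (4 * K))
    \<le> partial_recovery_loss n d p"
proof (rule partial_recovery_loss_geI)
  fix B assume B: "B \<in> estimators n d"
  define a where "a = max 0 (1 - \<delta>)"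
  \<comment> \<open>Up to a constant, \<open>\<rho>\<close> is the clique probability from
    \<open>mean_cliques_le\<close>. With \<open>q\<close> below, \<open>\<rho>\<close> equals
    \<open>2 * q\<close> to the power \<open>d choose 2\<close>, which gives the cancellation; the
    factor \<open>1 / 2\<close> in \<open>q\<close> keeps \<open>q \<le> 1 / 2\<close> even when
    \<open>a = 0\<close>.\<close>
  define \<rho> where "\<rho> = real n powr (- (real (d choose 2) * a))"
  define q where "q = real n powr (- a) / 2"
  define Y where "Y = \<eta> * ln n - ln (4 * K)"
  define M where "M = p * real (n choose d)"
  define A where "A = 2 ^ 2 ^ d * K ^ 2 ^ d"
  define C where "C = real (d choose 2) * ln 2 + real d ^ d / k + 2 * A"
  define \<Gamma> where "\<Gamma> = subset_mean (d_subsets n d) p (\<lambda>H. real (card (H \<inter> B (Proj H))))"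
  define \<Phi> where "\<Phi> = subset_mean (d_subsets n d) p (\<lambda>H. real (card (B (Proj H) - H)))"
  define T where "T = subset_mean (d_subsets n d) p (\<lambda>H. real (card (cliques n d (Proj H))))"
  have n1: "n \<ge> 1" using d n by simp
  have Y: "Y > 0" using X by (simp add: Y_def)
  have "0 < k * real n powr (- real d + 1 + \<delta>)" using k n1 by simp
  then have p0: "p > 0" using p by linarith
  have "n choose d > 0" using n by simp
  then have M: "M > 0" using p0 by (simp add: M_def)
  have \<rho>0: "\<rho> > 0" using n1 by (simp add: \<rho>_def)
  have A0: "A > 0" using K by (simp add: A_def)
  have \<Phi>0: "0 \<le> \<Phi>" and \<Gamma>0: "0 \<le> \<Gamma>"
    unfolding \<Phi>_def \<Gamma>_def using p0 p(1) subset_mean_mono[of p "d_subsets n d" "\<lambda>_. 0"]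
    by (auto simp: subset_mean_const finite_d_subsets)
  have ln\<rho>: "ln \<rho> = - (real (d choose 2) * a * ln n)" using n1 by (simp add: \<rho>_def ln_powr)
  have lnp: "ln p \<le> ln K + (- real d + 1 + \<delta>) * ln n"
  proof -
    have "ln p \<le> ln (K * real n powr (- real d + 1 + \<delta>))" using p p0 by (intro ln_mono) auto
    then show ?thesis using K n1 by (simp add: ln_mult ln_powr)
  qed
  have ln4: "ln (4 * K) = 2 * ln 2 + ln K"
    using K ln_realpow[of 2 2] by (simp add: ln_mult)
  \<comment> \<open>The 4 in \<open>ln (4 * K)\<close> pays for the 2 in the denominator and for a
    spare \<open>ln 2\<close>, which later offsets the cost \<open>ln 2 * \<Phi>\<close> of wrong
    guesses.\<close>
  have L: "Y + ln 2 \<le> ln (\<rho> / (2 * p))"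
    using ln\<rho> lnp ln4 p0 \<rho>0 by (simp add: Y_def \<eta> a_def ln_div ln_mult algebra_simps)
  have "ln (p / \<rho>) = - ln (\<rho> / (2 * p)) - ln 2" "ln (1 / 2 :: real) = - ln 2"
    using p0 \<rho>0 by (simp_all add: ln_div ln_mult)
  moreover have "0 < ln (2 :: real)" by simp
  ultimately have "ln (p / \<rho>) \<le> ln (1 / 2)" using L Y by linarith
  then have \<tau>: "p / \<rho> \<le> 1 / 2" using p0 \<rho>0 by (subst (asm) ln_le_cancel_iff) auto
  have q: "0 < q" "q \<le> 1 / 2"
    using n1 powr_mono[of "- a" 0 "real n"] by (auto simp: q_def a_def)
  have lnq: "ln (1 / q) = ln 2 + a * ln n"
    using n1 by (simp add: q_def ln_div ln_powr)
  \<comment> \<open>Non-edges cost at most \<open>n powr (2 - a)\<close>, and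
    \<open>a \<ge> 1 - \<delta>\<close> brings this down to the order of the number of
    hyperedges.\<close>
  have "2 * q * real (n choose 2) \<le> real d ^ d / k * M"
  proof -
    have "2 * q * real (n choose 2) \<le> real n powr (- a) * real n powr 2"
    proof -
      have "real n * (real n - 1) / 2 \<le> real n ^ 2"
        by (simp add: power2_eq_square algebra_simps)
      then have "real (n choose 2) \<le> real n powr 2" using n1 by (simp add: real_choose_two powr_numeral)
      then show ?thesis unfolding q_def by (simp add: mult_left_mono)
    qed
    also have "\<dots> \<le> real n powr (1 + \<delta>)"
      unfolding powr_add[symmetric] using n1 by (intro powr_mono) (auto simp: a_def)
    also have "\<dots> \<le> real d ^ d / k * M"
      using mean_hyperedges_ge[OF n n1 p(2)] k by (simp add: M_def field_simps)
    finally show ?thesis .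
  qed
  moreover have "2 * (p / \<rho>) * T \<le> 2 * A * M"
  proof -
    have "T \<le> real (n choose d) * (A * \<rho>)"
      unfolding T_def A_def \<rho>_def a_def
      using p p0 by (intro mean_cliques_le[OF n1 K _ _ p(3) \<delta>]) auto
    then have "2 * (p / \<rho>) * T \<le> 2 * (p / \<rho>) * (real (n choose d) * (A * \<rho>))"
      using p0 \<rho>0 by (intro mult_left_mono) auto
    also have "\<dots> = 2 * A * M" using \<rho>0 by (simp add: M_def)
    finally show ?thesis .
  qed
  moreover have "\<Gamma> * ln (\<rho> / (2 * p)) + M * ln (1 / \<rho>)
      \<le> real (d choose 2) * M * ln (1 / q) + 2 * q * real (n choose 2) + ln 2 * \<Phi> + 2 * (p / \<rho>) * T"
    unfolding \<Gamma>_def \<Phi>_def T_def M_def by (rule coding_inequality[OF p0 p(1) B \<rho>0 \<tau> q])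
  moreover have "M * ln (1 / \<rho>) = M * (real (d choose 2) * a * ln n)"
    using \<rho>0 by (simp add: ln_div ln\<rho>)
  moreover have "real (d choose 2) * M * ln (1 / q) = real (d choose 2) * ln 2 * M + M * (real (d choose 2) * a * ln n)"
    by (simp add: lnq algebra_simps)
  moreover have "C * M = real (d choose 2) * ln 2 * M + real d ^ d / k * M + 2 * A * M"
    by (simp add: C_def distrib_right)
  ultimately have "\<Gamma> * ln (\<rho> / (2 * p)) \<le> C * M + ln 2 * \<Phi>" by linarith
  moreover have "\<Gamma> * (Y + ln 2) \<le> \<Gamma> * ln (\<rho> / (2 * p))" using L \<Gamma>0 by (intro mult_left_mono)
  ultimately have key: "\<Gamma> * Y \<le> C * M + ln 2 * (\<Phi> - \<Gamma>)" by (simp add: algebra_simps)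
  have C0: "0 \<le> C" using A0 k by (simp add: C_def)
  \<comment> \<open>Either wrong guesses are at least as many on average as right ones, or the
    \<open>ln 2\<close> term in \<open>key\<close> is negative and can be discarded.\<close>
  have main: "\<Gamma> - \<Phi> \<le> C / Y * M"
  proof (cases "\<Gamma> \<le> \<Phi>")
    case True
    have "0 \<le> C / Y * M" using C0 Y M by simp
    then show ?thesis using True by linarith
  next
    case False
    then have "ln 2 * (\<Phi> - \<Gamma>) \<le> 0" by (intro mult_nonneg_nonpos) auto
    then have "\<Gamma> * Y \<le> C * M" using key by linarith
    then have "\<Gamma> \<le> C / Y * M" using Y by (simp add: field_simps)
    then show ?thesis using \<Phi>0 by linarith
  qed
  have "subset_mean (d_subsets n d) p (\<lambda>H. real (card (H - B (Proj H)))) = M - \<Gamma>"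
  proof -
    have "real (card (H - B (Proj H))) = real (card H) - real (card (H \<inter> B (Proj H)))"
      if "H \<subseteq> d_subsets n d" for H
    proof -
      have "finite H" using that finite_d_subsets finite_subset by blast
      then show ?thesis by (simp add: card_Diff_subset_Int of_nat_diff card_mono)
    qed
    then have "subset_mean (d_subsets n d) p (\<lambda>H. real (card (H - B (Proj H))))
      = subset_mean (d_subsets n d) p (\<lambda>H. real (card H) - real (card (H \<inter> B (Proj H))))"
      by (rule subset_mean_cong)
    then show ?thesis
      by (simp add: subset_mean_diff subset_mean_card finite_d_subsets card_d_subsets \<Gamma>_def M_def)
  qed
  then have "loss n d p B = (\<Phi> + (M - \<Gamma>)) / M"
    using loss_eq[OF less_imp_le[OF p0] less_imp_le[OF p(1)] B] by (simp add: \<Phi>_def M_def)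
  also have "\<dots> = 1 - (\<Gamma> - \<Phi>) / M" using M by (simp add: field_simps)
  also have "\<dots> \<ge> 1 - C / Y"
  proof -
    have "(\<Gamma> - \<Phi>) / M \<le> C / Y" using main M by (simp add: divide_le_eq)
    then show ?thesis by simp
  qed
  finally show "1 - (real (d choose 2) * ln 2 + real d ^ d / k + 2 * (2 ^ 2 ^ d * K ^ 2 ^ d)) / (\<eta> * ln n - ln (4 * K))
    \<le> loss n d p B"
    by (simp add: C_def Y_def A_def)
qed

section \<open>Passage to the limit\<close>

text \<open>For \<open>\<delta> < 1\<close>, twice the exponent factors as
  \<open>(d - 2) * (\<delta> * (d + 1) - (d - 1))\<close>; for \<open>\<delta> \<ge> 1\<close> it is
  just \<open>d - 1 - \<delta>\<close>.\<close>

lemma supercritical_exponent_pos: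
  assumes d: "d \<ge> 3" and \<delta>: "\<delta> < real d - 1" "(real d - 1) / (real d + 1) < \<delta>"
  shows "0 < real d - 1 - \<delta> - real (d choose 2) * max 0 (1 - \<delta>)"
proof (cases "\<delta> \<ge> 1")
  case True
  then show ?thesis using \<delta>(1) by (simp add: max_def)
next
  case False
  have "real d - 1 < \<delta> * (real d + 1)" using \<delta>(2) by (simp add: field_simps)
  then have "0 < (real d - 2) * (\<delta> * (real d + 1) - (real d - 1))"
    using d by (intro mult_pos_pos) auto
  then show ?thesis using False by (simp add: max_def real_choose_two field_simps)
qed

theorem theorem1:
  fixes d :: nat and \<delta> c :: real and p \<epsilon> :: "nat \<Rightarrow> real"
  assumes "d \<ge> 3" and "\<delta> < real d - 1" and "c > 0"
    and "\<epsilon> \<longlonglongrightarrow> 0"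
    and "\<And>n. n \<ge> 1 \<Longrightarrow> p n = (c + \<epsilon> n) * real n powr (- real d + 1 + \<delta>)"
  shows "(\<delta> < (real d - 1) / (real d + 1) \<longrightarrow>
            (\<lambda>n. partial_recovery_loss n d (p n)) \<longlonglongrightarrow> 0)
       \<and> (\<delta> > (real d - 1) / (real d + 1) \<longrightarrow>
            (\<lambda>n. partial_recovery_loss n d (p n)) \<longlonglongrightarrow> 1)"
proof -
  \<comment> \<open>Eventually \<open>c + \<epsilon> n\<close> lies between \<open>c / 2\<close> and
    \<open>2 * c\<close>; the maximum with 1 makes powers of \<open>K\<close> monotone in the
    exponent.\<close>
  define k where "k = c / 2"
  define K where "K = max 1 (2 * c)"
  have k: "k > 0" and K: "K \<ge> 1" using assms(3) by (auto simp: k_def K_def)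
  have powr0: "(\<lambda>n. real n powr (- s)) \<longlonglongrightarrow> 0" if "s > 0" for s
    by (intro tendsto_neg_powr filterlim_real_sequentially) (use that in simp)
  have "\<forall>\<^sub>F n in sequentially. \<bar>\<epsilon> n\<bar> < c / 2"
    using tendstoD[OF assms(4), of "c / 2"] assms(3) by simp
  then have bounds: "\<forall>\<^sub>F n in sequentially. k * real n powr (- real d + 1 + \<delta>) \<le> p n
      \<and> p n \<le> K * real n powr (- real d + 1 + \<delta>)"
    using eventually_ge_at_top[of 1]
  proof eventually_elim
    case (elim n)
    have "k \<le> c + \<epsilon> n" "c + \<epsilon> n \<le> K" using elim(1) assms(3) by (auto simp: k_def K_def max_def)
    then show ?case using assms(5)[OF elim(2)] by (auto intro: mult_right_mono)
  qed
  \<comment> \<open>Since \<open>\<delta> < d - 1\<close>, \<open>p n\<close> tends to 0, so it is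
    eventually a genuine probability below 1, not truncated by \<open>bernoulli_pmf\<close>.\<close>
  have "(\<lambda>n. K * real n powr (- (real d - 1 - \<delta>))) \<longlonglongrightarrow> K * 0"
    using assms(2) by (intro tendsto_mult_left powr0) simp
  moreover have "- (real d - 1 - \<delta>) = - real d + 1 + \<delta>" by simp
  ultimately have "(\<lambda>n. K * real n powr (- real d + 1 + \<delta>)) \<longlonglongrightarrow> K * 0" by metis
  then have "\<forall>\<^sub>F n in sequentially. K * real n powr (- real d + 1 + \<delta>) < 1"
    by (intro order_tendstoD(2)) auto
  then have ev: "\<forall>\<^sub>F n in sequentially. n \<ge> d \<and> n \<ge> 1 \<and> 0 < p n \<and> p n < 1
      \<and> k * real n powr (- real d + 1 + \<delta>) \<le> p n \<and> p n \<le> K * real n powr (- real d + 1 + \<delta>)"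
    using bounds eventually_ge_at_top[of "max 1 d"]
  proof eventually_elim
    case (elim n)
    have "0 < k * real n powr (- real d + 1 + \<delta>)" using k elim by simp
    then show ?case using elim by auto
  qed
  show ?thesis
  proof (intro conjI impI)
    assume \<delta>: "\<delta> < (real d - 1) / (real d + 1)"
    let ?b = "\<lambda>n. 2 ^ 2 ^ d * K ^ 2 ^ d / k * real n powr (- ((real d - 1) / (real d + 1) - \<delta>))"
    have lo: "\<forall>\<^sub>F n in sequentially. 0 \<le> partial_recovery_loss n d (p n)"
      using ev by eventually_elim (simp add: partial_recovery_loss_nonneg)
    have hi: "\<forall>\<^sub>F n in sequentially. partial_recovery_loss n d (p n) \<le> ?b n"
      using ev
      by eventually_elim
        (rule partial_recovery_loss_le_powr[OF _ _ K k], use assms(1) \<delta> in auto)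
    have "?b \<longlonglongrightarrow> 2 ^ 2 ^ d * K ^ 2 ^ d / k * 0"
      using \<delta> by (intro tendsto_mult_left powr0) simp
    then have "?b \<longlonglongrightarrow> 0" by simp
    then show "(\<lambda>n. partial_recovery_loss n d (p n)) \<longlonglongrightarrow> 0"
      by (rule tendsto_sandwich[OF lo hi tendsto_const])
  next
    assume \<delta>: "\<delta> > (real d - 1) / (real d + 1)"
    define \<eta> where "\<eta> = real d - 1 - \<delta> - real (d choose 2) * max 0 (1 - \<delta>)"
    have \<eta>: "\<eta> > 0" unfolding \<eta>_def by (rule supercritical_exponent_pos[OF assms(1,2) \<delta>])
    define C where "C = real (d choose 2) * ln 2 + real d ^ d / k + 2 * (2 ^ 2 ^ d * K ^ 2 ^ d)"
    have X: "filterlim (\<lambda>n::nat. \<eta> * ln (real n) - ln (4 * K)) at_top sequentially"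
    proof -
      have "filterlim (\<lambda>n::nat. - ln (4 * K) + \<eta> * ln (real n)) at_top sequentially"
        by (intro filterlim_tendsto_add_at_top[OF tendsto_const]
            filterlim_tendsto_pos_mult_at_top[OF tendsto_const \<eta>]
            filterlim_compose[OF ln_at_top filterlim_real_sequentially])
      then show ?thesis by (simp add: add.commute)
    qed
    let ?b = "\<lambda>n. 1 - C / (\<eta> * ln (real n) - ln (4 * K))"
    have hi: "\<forall>\<^sub>F n in sequentially. partial_recovery_loss n d (p n) \<le> 1"
      using ev by eventually_elim (simp add: partial_recovery_loss_le_1)
    have "\<forall>\<^sub>F n in sequentially. 0 < \<eta> * ln (real n) - ln (4 * K)"
      using X unfolding filterlim_at_top_dense by blast
    then have lo: "\<forall>\<^sub>F n in sequentially. ?b n \<le> partial_recovery_loss n d (p n)"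
      using ev
      by eventually_elim
        (unfold C_def, rule partial_recovery_loss_ge[OF _ _ K k], use assms(1) \<delta> in \<open>auto simp: \<eta>_def\<close>)
    have "?b \<longlonglongrightarrow> 1 - 0"
      by (intro tendsto_diff tendsto_const tendsto_divide_0[OF tendsto_const]
          filterlim_at_top_imp_at_infinity X)
    then have "?b \<longlonglongrightarrow> 1" by simp
    then show "(\<lambda>n. partial_recovery_loss n d (p n)) \<longlonglongrightarrow> 1"
      by (rule tendsto_sandwich[OF lo hi _ tendsto_const])
  qed
qed

end
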